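(* For every integer $k\ge1$, $$E^{(k-1)(k-2)\cdots1k}_{3\text{-}12}(x)=\begin{cases}\dfrac{e^{e^x}}{(k-1)!}\displaystyle\int_0^x t^{k-1}e^{-e^t+t}\,dt,&\text{if }k\ge2,\\[2mm] e^{e^x-1},&\text{if }k=1.\end{cases}$$
   Context: A permutation $\pi=\pi_1\cdots\pi_n$ of $\{1,\dots,n\}$ contains the generalized pattern $3\text{-}12$ if there are indices $i<j<n$ such that $\pi_i\pi_j\pi_{j+1}$ is order-isomorphic to $312$; otherwise it avoids it. A permutation $\pi$ begins with a pattern $p=p_1\cdots p_k$ if $n\ge k$ and $\pi_1\cdots\pi_k$ is order-isomorphic to $p$; by convention, the empty permutation is also regarded as beginning with the pattern $1$ (the case $k=1$). The pattern $(k-1)(k-2)\cdots1k$ consists of $k-1,k-2,\dots,1$ in decreasing order followed by $k$ (for $k=1$ it is $1$, for $k=2$ it is $12$). $E^p_q(x)=\sum_{n\ge0}N^p_q(n)\frac{x^n}{n!}$, where $N^p_q(n)$ is the number of permutations of $\{1,\dots,n\}$ that avoid $q$ and begin with $p$. Identities are identities of power series in $x$. *)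

theory Defs
  imports
    "HOL-Analysis.Analysis"
    "HOL-Combinatorics.Multiset_Permutations"
begin

text \<open>
  A permutation \<open>\<pi>\<^sub>1\<dots>\<pi>\<^sub>n\<close> of \<open>{1..n}\<close> is an element of \<^term>\<open>permutations_of_set {1..n}\<close>, that is,
  its word in one-line notation. List positions count from 0, so \<open>\<pi>\<^sub>i\<close> is \<open>xs ! (i - 1)\<close>.
\<close>

definition order_isomorphic :: "nat list \<Rightarrow> nat list \<Rightarrow> bool" where
  "order_isomorphic xs ys \<longleftrightarrow>
     length xs = length ys \<and>
     (\<forall>i<length xs. \<forall>j<length xs. xs ! i < xs ! j \<longleftrightarrow> ys ! i < ys ! j)"

text \<open>In \<open>3-12\<close> the last two letters have to be adjacent, the first two need not be.\<close>

definition contains_3_12 :: "nat list \<Rightarrow> bool" where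
  "contains_3_12 xs \<longleftrightarrow>
     (\<exists>i j. i < j \<and> j + 1 < length xs \<and>
        order_isomorphic [xs ! i, xs ! j, xs ! (j + 1)] [3, 1, 2])"

text \<open>The second disjunct is the convention that the empty permutation begins with the pattern 1.\<close>

definition begins_with :: "nat list \<Rightarrow> nat list \<Rightarrow> bool" where
  "begins_with p xs \<longleftrightarrow>
     (length p \<le> length xs \<and> order_isomorphic (take (length p) xs) p) \<or> (p = [1] \<and> xs = [])"

definition descent_then_max :: "nat \<Rightarrow> nat list" where
  "descent_then_max k = rev [1..<k] @ [k]"

definition count_avoiding_3_12 :: "nat list \<Rightarrow> nat \<Rightarrow> nat" where
  "count_avoiding_3_12 p n =
     card {xs \<in> permutations_of_set {1..n}. \<not> contains_3_12 xs \<and> begins_with p xs}"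

definition egf_avoiding_3_12 :: "nat list \<Rightarrow> real fps" where
  "egf_avoiding_3_12 p = Abs_fps (\<lambda>n. real (count_avoiding_3_12 p n) / fact n)"

end

theory Submission
  imports Defs
begin

text \<open>
  Split a permutation of length \<open>n + 1\<close> at its maximum into a prefix, the maximum and a suffix. It
  avoids \<open>3-12\<close> iff the prefix does and the suffix is decreasing, so it is determined by its
  prefix. It begins with \<open>(k-1)\<dots>1k\<close> iff the prefix does or, for \<open>k \<ge> 2\<close>, the prefix is the
  decreasing word of length \<open>k - 1\<close>. Choosing the letters of the prefix gives
  \<open>N (n + 1) = (\<Sum>j. (n choose j) * (N j + [k \<ge> 2 \<and> j = k - 1]))\<close>, which for the exponential
  generating function reads \<open>E' = (E + [k \<ge> 2] x^(k-1) / (k-1)!) e^x\<close>. This linear equation is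
  integrated with the factor \<open>exp (- e^x)\<close>; since \<open>N n \<le> n!\<close>, the series converges for \<open>|x| < 1\<close>.
\<close>

section \<open>Avoidance of 3-12 and the maximum\<close>

lemma contains_3_12_iff:
  "contains_3_12 xs \<longleftrightarrow>
     (\<exists>i j. i < j \<and> j + 1 < length xs \<and> xs ! j < xs ! (j + 1) \<and> xs ! (j + 1) < xs ! i)"
proof -
  have "order_isomorphic [a, b, c] [3, 1, 2] \<longleftrightarrow> b < c \<and> c < a" for a b c :: nat
    unfolding order_isomorphic_def by (auto simp: All_less_Suc numeral_3_eq_3)
  then show ?thesis
    unfolding contains_3_12_def by simp
qed

text \<open>Locate the adjacent ascent of an occurrence. It cannot end at \<open>m\<close>, since
  nothing exceeds \<open>m\<close>, nor start at \<open>m\<close>, since \<open>m\<close> is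
  followed by a smaller letter. So it lies in \<open>ys\<close>, where the whole occurrence then
  lies, or in \<open>zs\<close>. Conversely, \<open>m\<close> plays the 3 for any ascent of
  \<open>zs\<close>.\<close>

lemma contains_3_12_append_max:
  assumes dist: "distinct zs"
    and ys: "\<forall>y\<in>set ys. y < m"
    and zs: "\<forall>z\<in>set zs. z < m"
  shows "contains_3_12 (ys @ m # zs) \<longleftrightarrow> contains_3_12 ys \<or> \<not> sorted_wrt (>) zs"
    (is "contains_3_12 ?xs \<longleftrightarrow> _")
proof
  assume "contains_3_12 ?xs"
  then obtain i j where ij: "i < j" "j + 1 < length ?xs" "?xs ! j < ?xs ! (j + 1)"
      "?xs ! (j + 1) < ?xs ! i"
    unfolding contains_3_12_iff by blast
  consider "j + 1 < length ys" | "j + 1 = length ys" | "j = length ys" | "j > length ys"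
    by linarith
  then show "contains_3_12 ys \<or> \<not> sorted_wrt (>) zs"
  proof cases
    case 1
    with ij have "contains_3_12 ys"
      unfolding contains_3_12_iff by (intro exI[of _ i] exI[of _ j]) (auto simp: nth_append)
    then show ?thesis ..
  next
    case 2
    then have "?xs ! i = ys ! i" "i < length ys" "?xs ! (j + 1) = m"
      using ij by (auto simp: nth_append)
    with ij bspec[OF ys, of "ys ! i"] show ?thesis by auto
  next
    case 3
    then have "?xs ! j = m" "?xs ! (j + 1) = zs ! 0" "0 < length zs"
      using ij by (auto simp: nth_append)
    with ij bspec[OF zs, of "zs ! 0"] show ?thesis by auto
  next
    case 4
    \<comment> \<open>The position inside \<open>zs\<close> of letter \<open>j\<close> of the whole
      word; the 1 accounts for \<open>m\<close>.\<close>
    define l where "l = j - length ys - 1"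
    have "?xs ! j = zs ! l" "?xs ! (j + 1) = zs ! Suc l" "Suc l < length zs"
      using 4 ij by (auto simp: nth_append l_def nth_Cons' Suc_diff_Suc)
    with ij have "zs ! l < zs ! Suc l" "Suc l < length zs" by auto
    then have "\<not> sorted_wrt (>) zs"
      unfolding sorted_wrt_iff_nth_less by (metis lessI less_asym)
    then show ?thesis ..
  qed
next
  assume "contains_3_12 ys \<or> \<not> sorted_wrt (>) zs"
  then show "contains_3_12 ?xs"
  proof
    assume "contains_3_12 ys"
    then obtain i j where "i < j" "j + 1 < length ys" "ys ! j < ys ! (j + 1)"
      "ys ! (j + 1) < ys ! i"
      unfolding contains_3_12_iff by blast
    then show ?thesis
      unfolding contains_3_12_iff by (intro exI[of _ i] exI[of _ j]) (auto simp: nth_append)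
  next
    assume "\<not> sorted_wrt (>) zs"
    then obtain l where l: "Suc l < length zs" "\<not> zs ! l > zs ! Suc l"
      by (auto simp: sorted_wrt_iff_nth_Suc_transp)
    moreover have "zs ! l \<noteq> zs ! Suc l"
      using dist l by (simp add: nth_eq_iff_index_eq)
    moreover have "zs ! Suc l < m" using zs l by simp
    ultimately show ?thesis
      \<comment> \<open>The 3 is \<open>m\<close>, at position \<open>length ys\<close>; letter
        \<open>l\<close> of \<open>zs\<close> stands at \<open>length ys + Suc l\<close>.\<close>
      unfolding contains_3_12_iff
      by (intro exI[of _ "length ys"] exI[of _ "length ys + Suc l"]) (auto simp: nth_append)
  qed
qed

lemma sorted_wrt_greater_avoids_3_12:
  "sorted_wrt (>) xs \<Longrightarrow> \<not> contains_3_12 xs"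
  unfolding contains_3_12_iff sorted_wrt_iff_nth_less by (metis Suc_eq_plus1 less_asym lessI)

text \<open>A finite set has exactly one decreasing arrangement. This makes the suffix after the
  maximum a function of its letters.\<close>

lemma sorted_wrt_greater_iff:
  assumes "finite S"
  shows "xs \<in> permutations_of_set S \<and> sorted_wrt (>) xs \<longleftrightarrow> xs = rev (sorted_list_of_set S)"
proof
  assume "xs \<in> permutations_of_set S \<and> sorted_wrt (>) xs"
  then have "sorted_wrt (<) (rev xs)" "set (rev xs) = S"
    by (auto simp: permutations_of_set_def sorted_wrt_rev)
  then have "sorted_list_of_set S = rev xs"
    using assms sorted_list_of_set.idem_if_sorted_distinct strict_sorted_iff by metis
  then show "xs = rev (sorted_list_of_set S)" by simp
next
  assume "xs = rev (sorted_list_of_set S)"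
  then show "xs \<in> permutations_of_set S \<and> sorted_wrt (>) xs"
    using assms by (auto simp: permutations_of_set_def sorted_wrt_rev)
qed

section \<open>The initial pattern and the maximum\<close>

lemma length_descent_then_max [simp]: "k \<ge> 1 \<Longrightarrow> length (descent_then_max k) = k"
  by (simp add: descent_then_max_def)

lemma nth_descent_then_max:
  "i < k \<Longrightarrow> descent_then_max k ! i = (if i = k - 1 then k else k - 1 - i)"
  by (auto simp: descent_then_max_def nth_append rev_nth)

text \<open>The pattern is \<open>[1]\<close>: the first letter of a nonempty word matches it, and
  the empty word is covered by the convention.\<close>

lemma begins_with_descent_then_max_1 [simp]: "begins_with (descent_then_max (Suc 0)) xs"
  by (cases xs) (auto simp: begins_with_def descent_then_max_def order_isomorphic_def)

lemma begins_with_descent_then_max_iff: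
  assumes "k \<ge> 2"
  shows "begins_with (descent_then_max k) xs \<longleftrightarrow>
    k \<le> length xs \<and> sorted_wrt (>) (take (k - 1) xs) \<and> (\<forall>i<k-1. xs ! i < xs ! (k - 1))"
    (is "?L \<longleftrightarrow> ?R")
proof -
  let ?d = "descent_then_max k"
  have "?d \<noteq> [1]"
    using assms by (auto simp: descent_then_max_def dest: arg_cong[where f = last])
  then have L: "?L \<longleftrightarrow> k \<le> length xs \<and> (\<forall>i<k. \<forall>j<k. xs ! i < xs ! j \<longleftrightarrow> ?d ! i < ?d ! j)"
    using assms by (auto simp: begins_with_def order_isomorphic_def)
  \<comment> \<open>Position \<open>k - 1\<close> carries the largest letter of the pattern, and the
    positions before it are decreasing.\<close>
  have d: "?d ! i < ?d ! j \<longleftrightarrow> (j = k - 1 \<and> i < j) \<or> (j < i \<and> i < k - 1)"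
    if "i < k" "j < k" for i j
    using that by (auto simp: nth_descent_then_max)
  show ?thesis
  proof
    assume ?L
    then have len: "k \<le> length xs"
      and iso: "\<And>i j. i < k \<Longrightarrow> j < k \<Longrightarrow> xs ! i < xs ! j \<longleftrightarrow> ?d ! i < ?d ! j"
      by (auto simp: L)
    show ?R
      using len by (auto simp: sorted_wrt_iff_nth_less iso d)
  next
    assume R: ?R
    then have dec: "xs ! j < xs ! i" if "i < j" "j < k - 1" for i j
      using that by (auto simp: sorted_wrt_iff_nth_less)
    have "xs ! i < xs ! j \<longleftrightarrow> (j = k - 1 \<and> i < j) \<or> (j < i \<and> i < k - 1)"
      if ij: "i < k" "j < k" for i j
    proof -
      consider "i = j" | "i < j" "j = k - 1" | "i < j" "j < k - 1" | "j < i" "i = k - 1" | "j < i" "i < k - 1"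
        using ij by linarith
      then show ?thesis
        by cases (use R dec[of i j] dec[of j i] in \<open>auto dest: less_imp_not_less\<close>)
    qed
    then show ?L
      using R by (simp add: L d)
  qed
qed

text \<open>Within the first \<open>k\<close> letters, \<open>m\<close> can only stand last, because
  the last letter of the pattern is its largest. Hence the first \<open>k\<close> letters lie inside
  \<open>ys\<close>, or \<open>ys\<close> has length \<open>k - 1\<close> and \<open>m\<close>
  completes the pattern. For \<open>k = 1\<close> both sides are true.\<close>

lemma begins_with_append_max:
  assumes k: "k \<ge> 1"
    and ys: "\<forall>y\<in>set ys. y < m"
    and zs: "\<forall>z\<in>set zs. z < m"
  shows "begins_with (descent_then_max k) (ys @ m # zs) \<longleftrightarrow>
    begins_with (descent_then_max k) ys \<or> (k \<ge> 2 \<and> length ys = k - 1 \<and> sorted_wrt (>) ys)"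
    (is "?B (ys @ m # zs) \<longleftrightarrow> _")
proof (cases "k = 1")
  case False
  with k have k2: "k \<ge> 2" by simp
  note iff = begins_with_descent_then_max_iff[OF k2]
  consider "k \<le> length ys" | "k = length ys + 1" | "k > length ys + 1" by linarith
  then show ?thesis
  proof cases
    case 1
    \<comment> \<open>With this, \<open>take (k - 1)\<close> of the whole word reads letters of
      \<open>ys\<close> only.\<close>
    then have "k - Suc (length ys) = 0" by simp
    with 1 k2 show ?thesis by (auto simp: iff nth_append)
  next
    case 2
    with k2 ys show ?thesis by (subst (1 2) iff) (auto simp: nth_append)
  next
    case 3
    have "\<not> ?B (ys @ m # zs)"
    proof
      assume B: "?B (ys @ m # zs)"
      \<comment> \<open>The last letter of the pattern would fall in \<open>zs\<close>, after
        \<open>m\<close>, and would have to exceed \<open>m\<close>.\<close>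
      have "(ys @ m # zs) ! (k - 1) = zs ! (k - 2 - length ys)" "k - 2 - length ys < length zs"
        using B 3 by (auto simp: iff nth_append nth_Cons' numeral_2_eq_2)
      moreover have "(ys @ m # zs) ! length ys < (ys @ m # zs) ! (k - 1)"
        using B[unfolded iff] \<open>k > length ys + 1\<close> less_diff_conv by blast
      ultimately show False
        using bspec[OF zs, of "zs ! (k - 2 - length ys)"] by (simp add: nth_append)
    qed
    with 3 show ?thesis by (auto simp: iff)
  qed
qed simp

section \<open>Bijection between avoiders and prefixes before the maximum\<close>

text \<open>The letters form an arbitrary set, because prefixes before the maximum use arbitrary
  subsets of the letters.\<close>

definition avoiders :: "nat \<Rightarrow> nat set \<Rightarrow> nat list set" where
  "avoiders k S =
     {xs \<in> permutations_of_set S. \<not> contains_3_12 xs \<and> begins_with (descent_then_max k) xs}"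

text \<open>The words that may precede the maximum in an avoider; in the second alternative the
  maximum itself completes the pattern.\<close>

definition avoider_prefixes :: "nat \<Rightarrow> nat set \<Rightarrow> nat list set" where
  "avoider_prefixes k S = {xs \<in> permutations_of_set S. \<not> contains_3_12 xs \<and>
     (begins_with (descent_then_max k) xs \<or> (k \<ge> 2 \<and> length xs = k - 1 \<and> sorted_wrt (>) xs))}"

lemma finite_avoiders [simp]: "finite (avoiders k S)"
  by (simp add: avoiders_def)

lemma finite_avoider_prefixes [simp]: "finite (avoider_prefixes k S)"
  by (simp add: avoider_prefixes_def)

text \<open>The second alternative adds exactly one word, the decreasing arrangement of
  \<open>S\<close>. It is not among the avoiders already, being one letter too short to begin with
  the pattern.\<close>

lemma card_avoider_prefixes:
  assumes "finite S"
  shows "card (avoider_prefixes k S) = card (avoiders k S) + of_bool (k \<ge> 2 \<and> card S = k - 1)"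
proof (cases "k \<ge> 2 \<and> card S = k - 1")
  case True
  let ?d = "rev (sorted_list_of_set S)"
  have len: "length xs = card S" if "xs \<in> permutations_of_set S" for xs
    using that by (simp add: length_finite_permutations_of_set)
  have d: "?d \<in> permutations_of_set S" "sorted_wrt (>) ?d"
    using sorted_wrt_greater_iff[OF assms] by blast+
  have "avoider_prefixes k S = insert ?d (avoiders k S)"
  proof (rule set_eqI)
    fix xs
    have "length xs = k - 1" if "xs \<in> permutations_of_set S"
      using True len[OF that] by simp
    then show "xs \<in> avoider_prefixes k S \<longleftrightarrow> xs \<in> insert ?d (avoiders k S)"
      using True d sorted_wrt_greater_iff[OF assms, of xs] sorted_wrt_greater_avoids_3_12[of xs]
      unfolding avoider_prefixes_def avoiders_def mem_Collect_eq insert_iff by metis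
  qed
  moreover have "?d \<notin> avoiders k S"
    using True len[OF d(1)] by (auto simp: avoiders_def begins_with_descent_then_max_iff)
  ultimately show ?thesis using True by simp
next
  case False
  then have "avoider_prefixes k S = avoiders k S"
    by (auto simp: avoider_prefixes_def avoiders_def length_finite_permutations_of_set)
  then show ?thesis unfolding of_bool_eq(1) using False by simp
qed

lemma card_avoiders_insert_max:
  assumes k: "k \<ge> 1" and fin: "finite S" and m: "\<forall>x\<in>S. x < m"
  shows "card (avoiders k (insert m S)) = (\<Sum>U\<in>Pow S. card (avoider_prefixes k U))"
proof -
  let ?f = "\<lambda>ys. ys @ m # rev (sorted_list_of_set (S - set ys))"
  let ?A = "\<Union>U\<in>Pow S. avoider_prefixes k U"
  have set_prefix: "set ys = U" if "ys \<in> avoider_prefixes k U" for ys U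
    using that by (auto simp: avoider_prefixes_def permutations_of_set_def)
  have "m \<notin> S" using m by blast
  have "bij_betw ?f ?A (avoiders k (insert m S))"
  proof (rule bij_betwI[where g = "takeWhile (\<lambda>x. x \<noteq> m)"])
    show "?f \<in> ?A \<rightarrow> avoiders k (insert m S)"
    proof
      fix ys assume "ys \<in> ?A"
      then obtain U where U: "U \<subseteq> S" "ys \<in> avoider_prefixes k U" by auto
      then have set: "set ys = U" using set_prefix by blast
      let ?zs = "rev (sorted_list_of_set (S - set ys))"
      have zs: "set ?zs = S - U" "distinct ?zs" "sorted_wrt (>) ?zs"
        using fin set by (auto simp: sorted_wrt_rev)
      have lt: "\<forall>y\<in>set ys. y < m" "\<forall>z\<in>set ?zs. z < m"
        using m U set zs by blast+
      have "?f ys \<in> permutations_of_set (insert m S)"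
        using U set zs \<open>m \<notin> S\<close> fin
        by (auto simp: avoider_prefixes_def permutations_of_set_def)
      then show "?f ys \<in> avoiders k (insert m S)"
        using U zs contains_3_12_append_max[OF zs(2) lt] begins_with_append_max[OF k lt]
        by (auto simp: avoiders_def avoider_prefixes_def)
    qed
    \<comment> \<open>Both that the inverse map lands in \<open>?A\<close> and that
      \<open>?f\<close> undoes it.\<close>
    have split: "takeWhile (\<lambda>x. x \<noteq> m) xs \<in> ?A \<and> ?f (takeWhile (\<lambda>x. x \<noteq> m) xs) = xs"
      if xs: "xs \<in> avoiders k (insert m S)" for xs
    proof -
      have "distinct xs" "set xs = insert m S"
        using xs by (auto simp: avoiders_def permutations_of_set_def)
      then obtain ys zs where eq: "xs = ys @ m # zs"
        by (metis insertI1 split_list)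
      then have dist: "distinct ys" "distinct zs" "m \<notin> set ys" "m \<notin> set zs" "set ys \<inter> set zs = {}"
        using \<open>distinct xs\<close> by auto
      have sets: "set ys \<subseteq> S" "set zs = S - set ys"
        using eq dist \<open>set xs = insert m S\<close> \<open>m \<notin> S\<close> by auto
      have lt: "\<forall>y\<in>set ys. y < m" "\<forall>z\<in>set zs. z < m"
        using m sets by blast+
      have ys: "ys \<in> avoider_prefixes k (set ys)" and "sorted_wrt (>) zs"
        using xs dist contains_3_12_append_max[OF dist(2) lt] begins_with_append_max[OF k lt]
        by (auto simp: avoiders_def avoider_prefixes_def eq)
      then have "zs = rev (sorted_list_of_set (S - set ys))"
        using sorted_wrt_greater_iff[of "S - set ys" zs] fin sets dist
        by (auto simp: permutations_of_set_def)
      moreover have "takeWhile (\<lambda>x. x \<noteq> m) xs = ys"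
        using dist eq by (auto simp: takeWhile_tail takeWhile_append)
      ultimately show ?thesis using eq ys sets by auto
    qed
    show "takeWhile (\<lambda>x. x \<noteq> m) \<in> avoiders k (insert m S) \<rightarrow> ?A"
      using split by blast
    show "?f (takeWhile (\<lambda>x. x \<noteq> m) xs) = xs" if "xs \<in> avoiders k (insert m S)" for xs
      using split[OF that] by blast
    show "takeWhile (\<lambda>x. x \<noteq> m) (?f ys) = ys" if "ys \<in> ?A" for ys
    proof -
      have "m \<notin> set ys" using that set_prefix \<open>m \<notin> S\<close> by blast
      then show ?thesis by (auto simp: takeWhile_append)
    qed
  qed
  then have "card (avoiders k (insert m S)) = card ?A"
    by (simp add: bij_betw_same_card)
  also have "\<dots> = (\<Sum>U\<in>Pow S. card (avoider_prefixes k U))"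
  proof (rule card_UN_disjoint)
    show "finite (Pow S)" using fin by simp
    show "\<forall>U\<in>Pow S. finite (avoider_prefixes k U)" by simp
    show "\<forall>U\<in>Pow S. \<forall>V\<in>Pow S. U \<noteq> V \<longrightarrow> avoider_prefixes k U \<inter> avoider_prefixes k V = {}"
      using set_prefix by (metis disjoint_iff)
  qed
  finally show ?thesis .
qed

section \<open>The recurrence\<close>

lemma sum_Pow_card:
  fixes g :: "nat \<Rightarrow> nat"
  assumes "finite S"
  shows "(\<Sum>U\<in>Pow S. g (card U)) = (\<Sum>j\<le>card S. (card S choose j) * g j)"
proof -
  have "(\<Sum>U\<in>Pow S. g (card U)) = (\<Sum>j\<le>card S. \<Sum>U\<in>{U \<in> Pow S. card U = j}. g (card U))"
    using assms by (intro sum.group[symmetric]) (auto intro: card_mono)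
  also have "\<dots> = (\<Sum>j\<le>card S. (card S choose j) * g j)"
    using n_subsets[OF assms] by (intro sum.cong) auto
  finally show ?thesis .
qed

lemma count_avoiding_eq_card_avoiders:
  "count_avoiding_3_12 (descent_then_max k) n = card (avoiders k {1..n})"
  by (simp add: count_avoiding_3_12_def avoiders_def)

text \<open>The hypothesis that counts on subsets of \<open>S\<close> depend only on cardinality is
  kept explicit, so that an induction hypothesis can discharge it in the proof of
  \<open>card_avoiders\<close>.\<close>

lemma card_avoiders_insert_max_eq_sum:
  assumes k: "k \<ge> 1" and fin: "finite S" and m: "\<forall>x\<in>S. x < m"
    and card: "\<And>U. U \<subseteq> S \<Longrightarrow> card (avoiders k U) = a (card U)"
  shows "card (avoiders k (insert m S)) =
    (\<Sum>j\<le>card S. (card S choose j) * (a j + of_bool (k \<ge> 2 \<and> j = k - 1)))"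
proof -
  have "card (avoiders k (insert m S)) =
      (\<Sum>U\<in>Pow S. a (card U) + of_bool (k \<ge> 2 \<and> card U = k - 1))"
    unfolding card_avoiders_insert_max[OF k fin m]
    using fin card by (intro sum.cong) (auto simp: card_avoider_prefixes finite_subset)
  then show ?thesis
    using sum_Pow_card[OF fin, of "\<lambda>j. a j + of_bool (k \<ge> 2 \<and> j = k - 1)"] by simp
qed

text \<open>Only the relative order of letters matters. Instead of relabelling words, strong
  induction on the cardinality removes the maximum from \<open>S\<close> and from
  \<open>{1..Suc n}\<close>; both counts become the same sum.\<close>

lemma card_avoiders:
  assumes k: "k \<ge> 1" and "finite S"
  shows "card (avoiders k S) = count_avoiding_3_12 (descent_then_max k) (card S)"
  using \<open>finite S\<close>
proof (induction "card S" arbitrary: S rule: less_induct)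
  case less
  show ?case
  proof (cases "card S")
    case 0
    with less.prems show ?thesis by (simp add: count_avoiding_eq_card_avoiders)
  next
    case (Suc n)
    let ?a = "count_avoiding_3_12 (descent_then_max k)"
    have IH: "card (avoiders k U) = ?a (card U)" if "finite U" "card U \<le> n" for U
      using less.hyps[of U] that Suc by simp
    have eq: "card (avoiders k (insert m T)) =
        (\<Sum>j\<le>n. (n choose j) * (?a j + of_bool (k \<ge> 2 \<and> j = k - 1)))"
      if "finite T" "card T = n" "\<forall>x\<in>T. x < m" for m T
    proof -
      have "card (avoiders k U) = ?a (card U)" if "U \<subseteq> T" for U
        using IH[of U] that \<open>finite T\<close> \<open>card T = n\<close> card_mono finite_subset by metis
      from card_avoiders_insert_max_eq_sum[OF k that(1,3) this] show ?thesis
        using that(2) by simp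
    qed
    have "S \<noteq> {}" using Suc by auto
    then have "insert (Max S) (S - {Max S}) = S" "card (S - {Max S}) = n"
      using less.prems Suc by (auto simp: insert_absorb)
    then have "card (avoiders k S) =
        (\<Sum>j\<le>n. (n choose j) * (?a j + of_bool (k \<ge> 2 \<and> j = k - 1)))"
      using eq[of "S - {Max S}" "Max S"] less.prems by (auto simp: le_neq_trans)
    also have "\<dots> = card (avoiders k {1..Suc n})"
      using eq[of "{1..n}" "Suc n"] by (simp add: atLeastAtMostSuc_conv)
    finally show ?thesis by (simp add: count_avoiding_eq_card_avoiders Suc)
  qed
qed

lemma count_avoiding_Suc:
  assumes "k \<ge> 1"
  shows "count_avoiding_3_12 (descent_then_max k) (Suc n) =
    (\<Sum>j\<le>n. (n choose j) *
       (count_avoiding_3_12 (descent_then_max k) j + of_bool (k \<ge> 2 \<and> j = k - 1)))"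
proof -
  have "card (avoiders k U) = count_avoiding_3_12 (descent_then_max k) (card U)"
    if "U \<subseteq> {1..n}" for U
    using card_avoiders[OF assms] finite_subset[OF that] by simp
  then have "card (avoiders k (insert (Suc n) {1..n})) =
      (\<Sum>j\<le>card {1..n}. (card {1..n} choose j) *
        (count_avoiding_3_12 (descent_then_max k) j + of_bool (k \<ge> 2 \<and> j = k - 1)))"
    by (intro card_avoiders_insert_max_eq_sum[OF assms]) auto
  moreover have "insert (Suc n) {1..n} = {1..Suc n}" by auto
  ultimately show ?thesis
    unfolding count_avoiding_eq_card_avoiders[of k "Suc n"] by simp
qed

text \<open>The convention on the empty permutation supplies the initial value 1 for
  \<open>k = 1\<close>.\<close>

lemma count_avoiding_0:
  assumes "k \<ge> 1"
  shows "count_avoiding_3_12 (descent_then_max k) 0 = of_bool (k = 1)"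
proof -
  have "contains_3_12 [] = False" by (simp add: contains_3_12_def)
  moreover have "begins_with (descent_then_max k) [] \<longleftrightarrow> k = 1"
    using assms by (cases "k = 1") (auto simp: begins_with_descent_then_max_iff)
  ultimately have "avoiders k {} = (if k = 1 then {[]} else {})"
    by (auto simp: avoiders_def)
  then show ?thesis by (simp add: count_avoiding_eq_card_avoiders)
qed

section \<open>The generating function and its differential equation\<close>

text \<open>Dividing the recurrence by \<open>fact n\<close> turns the binomial sum into a Cauchy
  product with the exponential series.\<close>

lemma fps_deriv_egf_avoiding:
  assumes "k \<ge> 1"
  shows "fps_deriv (egf_avoiding_3_12 (descent_then_max k)) =
    (egf_avoiding_3_12 (descent_then_max k) +
     fps_const (of_bool (k \<ge> 2) / fact (k - 1)) * fps_X ^ (k - 1)) * fps_exp 1"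
    (is "_ = ?rhs")
proof (rule fps_ext)
  fix n
  let ?N = "count_avoiding_3_12 (descent_then_max k)"
  have "fps_nth (fps_deriv (egf_avoiding_3_12 (descent_then_max k))) n = real (?N (Suc n)) / fact n"
    by (simp add: egf_avoiding_3_12_def fact_Suc del: of_nat_Suc)
  also have "\<dots> = (\<Sum>j\<le>n. (real (?N j) + of_bool (k \<ge> 2 \<and> j = k - 1)) / fact j / fact (n - j))"
    unfolding count_avoiding_Suc[OF assms] of_nat_sum sum_divide_distrib
    by (intro sum.cong) (auto simp: binomial_fact field_simps)
  also have "\<dots> = fps_nth ?rhs n"
    unfolding fps_mult_nth[of _ "fps_exp 1"] atLeast0AtMost
    by (intro sum.cong) (auto simp: egf_avoiding_3_12_def add_divide_distrib)
  finally show "fps_nth (fps_deriv (egf_avoiding_3_12 (descent_then_max k))) n = fps_nth ?rhs n" .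
qed

text \<open>The coefficients lie between 0 and 1, so a geometric series dominates.\<close>

lemma fps_conv_radius_egf_avoiding: "fps_conv_radius (egf_avoiding_3_12 p) \<ge> 1"
  unfolding fps_conv_radius_def
proof (rule conv_radius_geI_ex)
  fix r :: real assume r: "0 < r" "ereal r < 1"
  have "count_avoiding_3_12 p n \<le> fact n" for n
  proof -
    have "count_avoiding_3_12 p n \<le> card (permutations_of_set {1..n})"
      unfolding count_avoiding_3_12_def by (intro card_mono) auto
    then show ?thesis by simp
  qed
  then have "real (count_avoiding_3_12 p n) \<le> fact n" for n
    by (metis of_nat_fact of_nat_le_iff)
  then have "norm (fps_nth (egf_avoiding_3_12 p) n * r ^ n) \<le> r ^ n" for n
    using r by (simp add: egf_avoiding_3_12_def divide_le_eq mult.commute)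
  then have "summable (\<lambda>n. fps_nth (egf_avoiding_3_12 p) n * r ^ n)"
    using r by (intro summable_comparison_test'[OF summable_geometric[of r]]) auto
  then show "\<exists>z. norm z = r \<and> summable (\<lambda>n. fps_nth (egf_avoiding_3_12 p) n * z ^ n)"
    using r by (intro exI[of _ r]) auto
qed

text \<open>The derivative of \<open>exp (- exp x)\<close> contributes \<open>- exp x\<close> times
  the product, which cancels the term \<open>f x * exp x\<close> of the differential
  equation.\<close>

lemma has_real_derivative_egf_avoiding:
  fixes x :: real
  assumes "k \<ge> 1" and x: "\<bar>x\<bar> < 1"
  defines "f \<equiv> eval_fps (egf_avoiding_3_12 (descent_then_max k))"
  shows "((\<lambda>x. f x * exp (- exp x)) has_real_derivative
    of_bool (k \<ge> 2) / fact (k - 1) * (x ^ (k - 1) * exp (- exp x + x))) (at x within A)"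
proof -
  let ?F = "egf_avoiding_3_12 (descent_then_max k)"
  let ?c = "of_bool (k \<ge> 2) / fact (k - 1) :: real"
  let ?P = "fps_const ?c * fps_X ^ (k - 1) :: real fps"
  have rF: "ereal (norm x) < fps_conv_radius ?F"
    using fps_conv_radius_egf_avoiding[of "descent_then_max k"] x
    by (metis ereal_less(3) less_le_trans real_norm_def)
  have rP: "fps_conv_radius ?P = \<infinity>"
    using fps_conv_radius_mult[of "fps_const ?c" "fps_X ^ (k - 1) :: real fps"] by simp
  have rFP: "ereal (norm x) < fps_conv_radius (?F + ?P)"
    using rF rP fps_conv_radius_add[of ?F ?P] by auto
  have "eval_fps (fps_deriv ?F) x = (f x + ?c * x ^ (k - 1)) * exp x"
    unfolding fps_deriv_egf_avoiding[OF assms(1)] f_def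
    using rF rP rFP by (simp add: eval_fps_mult eval_fps_add)
  then have "(f has_real_derivative (f x + ?c * x ^ (k - 1)) * exp x) (at x within A)"
    using has_field_derivative_eval_fps[OF rF, of A] by (simp add: f_def)
  then show ?thesis
    by (auto intro!: derivative_eq_intros simp: exp_diff exp_minus field_simps)
qed

theorem proposition26:
  fixes k :: nat
  assumes "k \<ge> 1"
  shows "(\<lambda>x::real.
            if k \<ge> 2
            then exp (exp x) / fact (k - 1) *
                   (LBINT t=ereal 0..ereal x. t ^ (k - 1) * exp (- exp t + t))
            else exp (exp x - 1))
         has_fps_expansion egf_avoiding_3_12 (descent_then_max k)"
    (is "?g has_fps_expansion ?F")
  unfolding has_fps_expansion_def
proof
  show "fps_conv_radius ?F > 0"
    by (rule less_le_trans[OF _ fps_conv_radius_egf_avoiding]) simp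
  have "eval_fps ?F x = ?g x" if x: "\<bar>x\<bar> < 1" for x
  proof -
    let ?h = "\<lambda>x. eval_fps ?F x * exp (- exp x)"
    have "(LBINT t=ereal 0..ereal x.
        of_bool (k \<ge> 2) / fact (k - 1) * (t ^ (k - 1) * exp (- exp t + t))) = ?h x - ?h 0"
    proof (rule interval_integral_FTC_finite)
      \<comment> \<open>Using \<open>min\<close> and \<open>max\<close> covers negative
        \<open>x\<close> as well.\<close>
      show "(?h has_vector_derivative
          of_bool (k \<ge> 2) / fact (k - 1) * (t ^ (k - 1) * exp (- exp t + t)))
          (at t within {min 0 x..max 0 x})" if "min 0 x \<le> t" "t \<le> max 0 x" for t
      proof -
        have "\<bar>t\<bar> < 1" using that x by linarith
        from has_real_derivative_egf_avoiding[OF assms this] show ?thesis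
          unfolding has_real_derivative_iff_has_vector_derivative .
      qed
    qed (intro continuous_intros)
    \<comment> \<open>The constant of integration separates the cases: it vanishes for
      \<open>k \<ge> 2\<close>, while for \<open>k = 1\<close> the integral term vanishes and
      \<open>?h\<close> is constantly \<open>exp (- 1)\<close>.\<close>
    moreover have "?h 0 = of_bool (k = 1) * exp (- 1)"
      by (simp add: eval_fps_at_0 egf_avoiding_3_12_def count_avoiding_0[OF assms])
    ultimately have "?h x = of_bool (k \<ge> 2) / fact (k - 1) *
        (LBINT t=ereal 0..ereal x. t ^ (k - 1) * exp (- exp t + t)) + of_bool (k = 1) * exp (- 1)"
      by simp
    moreover have "eval_fps ?F x = ?h x * exp (exp x)"
      by (simp add: exp_minus)
    ultimately show ?thesis
      using assms by (auto simp: exp_diff exp_minus field_simps)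
  qed
  \<comment> \<open>An expansion at 0 only asks for equality near 0.\<close>
  moreover have "\<forall>\<^sub>F x in nhds 0. \<bar>x :: real\<bar> < 1"
    using eventually_nhds_in_open[of "ball (0::real) 1" 0] by (simp add: dist_real_def)
  ultimately show "\<forall>\<^sub>F x in nhds 0. eval_fps ?F x = ?g x"
    by (rule eventually_mono[rotated])
qed

end
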